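(* Let $X$ be a complete proper visibility CAT(0) space and let $\Gamma_0$ be a group of isometries of $X$ generated by a finite symmetric set $S$. Assume that there exists a point $\xi \in X(\infty)$ such that $\mathrm{Fix}(\varphi)=\{\xi\}$ for every $\varphi \in \Gamma_0 \setminus \{e\}$. Then for any $x \in X$ we have $$\lim_{k \to \infty}\frac{\max_{\varphi\in\Gamma_0,\ |\varphi |_w \leq k} d(x, \varphi(x))}{k}=0,$$ where $|\cdot|_w$ is the word norm with respect to $S$.
   Context: A CAT(0) space is a complete geodesic metric space $X$ such that for all $x,y,z\in X$, $d^2(z,m)\le \frac12(d^2(z,x)+d^2(z,y))-\frac14 d^2(x,y)$, where $m$ is the midpoint of the geodesic segment from $x$ to $y$. $X$ is proper if all closed bounded sets are compact. The geometric boundary $X(\infty)$ is the set of geodesic rays (parametrized by arc length) modulo the relation $\gamma_1\sim\gamma_2$ iff $d(\gamma_1(t),\gamma_2(t))$ is bounded for $t\ge0$; isometries of $X$ act on $X(\infty)$. $X$ is a visibility CAT(0) space if for any two distinct $\xi,\eta\in X(\infty)$ there is a geodesic line $\gamma:\mathbb{R}\to X$ with $\gamma(-\infty)=\xi$ and $\gamma(\infty)=\eta$. For an isometry $\varphi$, $\mathrm{Fix}(\varphi)=\{\eta\in X(\infty):\varphi(\eta)=\eta\}$. A set $S\subset\Gamma_0$ is symmetric if it is closed under inverses; the word norm $|\varphi|_w$ of $\varphi\in\Gamma_0$ is the length of a shortest word over $S$ representing $\varphi$. $e$ is the identity element. *)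

theory Defs
  imports "HOL-Analysis.Analysis" "HOL-Algebra.Generated_Groups"
begin

definition geodesic_segment :: "(real \<Rightarrow> 'a::metric_space) \<Rightarrow> 'a \<Rightarrow> 'a \<Rightarrow> bool" where
  "geodesic_segment c x y \<longleftrightarrow> c 0 = x \<and> c (dist x y) = y \<and>
     (\<forall>s\<in>{0..dist x y}. \<forall>t\<in>{0..dist x y}. dist (c s) (c t) = \<bar>s - t\<bar>)"

definition cat0_space :: "'a::metric_space itself \<Rightarrow> bool" where
  "cat0_space _ \<longleftrightarrow> complete (UNIV :: 'a set) \<and>
     (\<forall>x y :: 'a. \<exists>c. geodesic_segment c x y) \<and>
     (\<forall>(x :: 'a) y z c. geodesic_segment c x y \<longrightarrow>
        (dist z (c (dist x y / 2)))\<^sup>2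
          \<le> 1/2 * ((dist z x)\<^sup>2 + (dist z y)\<^sup>2) - 1/4 * (dist x y)\<^sup>2)"

definition proper_space :: "'a::metric_space itself \<Rightarrow> bool" where
  "proper_space _ \<longleftrightarrow> (\<forall>A :: 'a set. closed A \<and> bounded A \<longrightarrow> compact A)"

text \<open>Rays are functions on all of \<open>\<real>\<close>; only their values on \<open>[0, \<infinity>)\<close> are
  constrained. The values at negative arguments do not affect the boundary, since the
  relation below identifies rays that agree on \<open>[0, \<infinity>)\<close>.\<close>

definition geodesic_ray :: "(real \<Rightarrow> 'a::metric_space) \<Rightarrow> bool" where
  "geodesic_ray c \<longleftrightarrow> (\<forall>s\<ge>0. \<forall>t\<ge>0. dist (c s) (c t) = \<bar>s - t\<bar>)"

definition geodesic_line :: "(real \<Rightarrow> 'a::metric_space) \<Rightarrow> bool" where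
  "geodesic_line c \<longleftrightarrow> (\<forall>s t. dist (c s) (c t) = \<bar>s - t\<bar>)"

definition asymptotic :: "((real \<Rightarrow> 'a::metric_space) \<times> (real \<Rightarrow> 'a)) set" where
  "asymptotic = {(c, c'). geodesic_ray c \<and> geodesic_ray c' \<and>
                   (\<exists>B. \<forall>t\<ge>0. dist (c t) (c' t) \<le> B)}"

definition boundary_at_infinity :: "(real \<Rightarrow> 'a::metric_space) set set" where
  "boundary_at_infinity = {c. geodesic_ray c} // asymptotic"

definition ray_end :: "(real \<Rightarrow> 'a::metric_space) \<Rightarrow> (real \<Rightarrow> 'a) set" where
  "ray_end c = asymptotic `` {c}"

definition visibility_space :: "'a::metric_space itself \<Rightarrow> bool" where
  "visibility_space _ \<longleftrightarrow>
     (\<forall>\<xi>\<in>boundary_at_infinity. \<forall>\<eta>\<in>boundary_at_infinity. \<xi> \<noteq> \<eta> \<longrightarrow>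
        (\<exists>c :: real \<Rightarrow> 'a. geodesic_line c \<and> ray_end (\<lambda>t. c (- t)) = \<xi> \<and> ray_end c = \<eta>))"

definition isometry :: "('a::metric_space \<Rightarrow> 'a) \<Rightarrow> bool" where
  "isometry f \<longleftrightarrow> bij f \<and> (\<forall>x y. dist (f x) (f y) = dist x y)"

definition isom_group :: "('a::metric_space \<Rightarrow> 'a) monoid" where
  "isom_group = \<lparr>carrier = {f. isometry f}, mult = (\<circ>), one = id\<rparr>"

text \<open>The action \<open>[c] \<mapsto> [f \<circ> c]\<close>. All rays \<open>c \<in> \<xi>\<close> give the same class
  (lemma \<open>boundary_action_ray_end\<close>), so the union is that class.\<close>

definition boundary_action ::
    "('a::metric_space \<Rightarrow> 'a) \<Rightarrow> (real \<Rightarrow> 'a) set \<Rightarrow> (real \<Rightarrow> 'a) set" where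
  "boundary_action f \<xi> = (\<Union>c\<in>\<xi>. ray_end (f \<circ> c))"

definition boundary_fix :: "('a::metric_space \<Rightarrow> 'a) \<Rightarrow> (real \<Rightarrow> 'a) set set" where
  "boundary_fix f = {\<eta> \<in> boundary_at_infinity. boundary_action f \<eta> = \<eta>}"

text \<open>Meaningful only for \<open>g\<close> that is a product of elements of \<open>S\<close>; for symmetric \<open>S\<close>
  these are exactly the elements of \<open>generate G S\<close>. The unit has norm 0 (empty word).\<close>

definition word_norm :: "('a, 'b) monoid_scheme \<Rightarrow> 'a set \<Rightarrow> 'a \<Rightarrow> nat" where
  "word_norm G S g =
     (LEAST n. \<exists>w. set w \<subseteq> S \<and> length w = n \<and> foldr (mult G) w \<one>\<^bsub>G\<^esub> = g)"

lemma isometry_inv: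
  assumes "isometry f"
  shows "isometry (inv_into UNIV f)"
  unfolding isometry_def
proof (intro conjI allI)
  have f: "bij f" "\<And>x y. dist (f x) (f y) = dist x y"
    using assms by (auto simp: isometry_def)
  show "bij (inv_into UNIV f)"
    by (rule bij_imp_bij_inv[OF f(1)])
  fix x y
  show "dist (inv_into UNIV f x) (inv_into UNIV f y) = dist x y"
    using f(2)[of "inv_into UNIV f x" "inv_into UNIV f y"]
    by (simp add: surj_f_inv_f[OF bij_is_surj[OF f(1)]])
qed

lemma group_isom_group: "group isom_group"
proof (rule groupI)
  fix f :: "'a \<Rightarrow> 'a"
  assume "f \<in> carrier isom_group"
  then have f: "isometry f" by (simp add: isom_group_def)
  then have "inv_into UNIV f \<circ> f = id"
    by (simp add: isometry_def bij_is_inj)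
  then show "\<exists>g\<in>carrier isom_group. g \<otimes>\<^bsub>isom_group\<^esub> f = \<one>\<^bsub>isom_group\<^esub>"
    using isometry_inv[OF f] by (auto simp: isom_group_def)
qed (auto simp: isom_group_def isometry_def o_assoc bij_comp)

lemma equiv_asymptotic:
  "equiv {c :: real \<Rightarrow> 'a::metric_space. geodesic_ray c} asymptotic"
proof (rule equivI)
  show "trans (asymptotic :: ((real \<Rightarrow> 'a) \<times> (real \<Rightarrow> 'a)) set)"
  proof (rule transI)
    fix a b c :: "real \<Rightarrow> 'a"
    assume ab: "(a, b) \<in> asymptotic" and bc: "(b, c) \<in> asymptotic"
    obtain A B where "\<forall>t\<ge>0. dist (a t) (b t) \<le> A" "\<forall>t\<ge>0. dist (b t) (c t) \<le> B"
      using ab bc unfolding asymptotic_def by auto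
    then have "\<forall>t\<ge>0. dist (a t) (c t) \<le> A + B"
      by (meson add_mono dist_triangle order_trans)
    then show "(a, c) \<in> asymptotic"
      using ab bc unfolding asymptotic_def by auto
  qed
next
  show "sym (asymptotic :: ((real \<Rightarrow> 'a) \<times> (real \<Rightarrow> 'a)) set)"
    unfolding asymptotic_def by (rule symI) (auto simp: dist_commute)
qed (auto simp: refl_on_def asymptotic_def)

lemma boundary_action_ray_end:
  assumes f: "isometry f" and c: "geodesic_ray c"
  shows "boundary_action f (ray_end c) = ray_end (f \<circ> c)"
proof -
  have same: "ray_end (f \<circ> c') = ray_end (f \<circ> c)" if "c' \<in> ray_end c" for c'
  proof -
    have "(f \<circ> c, f \<circ> c') \<in> asymptotic"
      using that f by (simp add: ray_end_def asymptotic_def geodesic_ray_def isometry_def)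
    then show ?thesis
      unfolding ray_end_def using equiv_class_eq[OF equiv_asymptotic] by blast
  qed
  have "c \<in> ray_end c"
    using c by (auto simp: ray_end_def asymptotic_def)
  then show ?thesis
    unfolding boundary_action_def using same by blast
qed

end

theory Submission imports Defs begin

text \<open>Suppose the displacement grows linearly along some words. Maximising
  \<open>dist (P i) (P n) + e i\<close> along the orbit path \<open>P\<close> of a long word and discarding the first \<open>i\<close>
  letters yields paths from \<open>x\<close> to \<open>y\<close> that approach \<open>y\<close> at speed at least \<open>e\<close> at every time. A
  limit of the segments \<open>[x, y]\<close> is a ray \<open>\<gamma>\<close> whose Busemann function is unbounded below on the
  orbit of \<open>x\<close>. Applied to the powers of a single isometry that shifts the Busemann function of
  \<open>\<xi>\<close> upwards, this gives a second fixed point \<open>\<gamma>(\<infinity>)\<close>; hence the group preserves the Busemann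
  function of \<open>\<xi>\<close>. In particular \<open>\<gamma>(\<infinity>) \<noteq> \<xi>\<close>, and visibility provides a line joining the two
  points. By the triangle inequality the sum of the Busemann functions of its two ends is
  nonnegative everywhere, so the one of \<open>\<gamma>\<close> is bounded below on the orbit, a contradiction.\<close>

section \<open>Midpoint convex functions on an interval\<close>

text \<open>Subtract the chord. The leftmost maximum of the difference cannot be interior, since
  midpoint convexity on a small symmetric interval would bound it by the mean of a strictly smaller
  value and a value that is no larger. So the maximum is attained at an end, where the difference is
  0.\<close>

lemma midpoint_convex_le_chord:
  fixes f :: "real \<Rightarrow> real"
  assumes cont: "continuous_on {0..D} f"
    and mid: "\<And>s t. 0 \<le> s \<Longrightarrow> s \<le> t \<Longrightarrow> t \<le> D \<Longrightarrow> f ((s + t) / 2) \<le> (f s + f t) / 2"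
    and t: "0 \<le> t" "t \<le> D" and D: "D > 0"
  shows "f t \<le> (1 - t / D) * f 0 + t / D * f D"
proof -
  define k where "k = (f D - f 0) / D"
  define g where "g s = f s - f 0 - s * k" for s
  have g0: "g 0 = 0" "g D = 0" using D by (simp_all add: g_def k_def)
  have cg: "continuous_on {0..D} g"
    unfolding g_def by (intro continuous_intros cont)
  obtain m where m: "m \<in> {0..D}" "\<And>s. s \<in> {0..D} \<Longrightarrow> g s \<le> g m"
    using continuous_attains_sup[OF _ _ cg] t by auto
  define A where "A = {s \<in> {0..D}. g s = g m}"
  have "A = {0..D} \<inter> g -` {g m}" by (auto simp: A_def)
  then have "closed A" using continuous_closed_preimage[OF cg] by auto
  moreover have bdd: "bdd_below A" by (auto simp: A_def intro!: bdd_belowI[of _ 0])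
  moreover have "A \<noteq> {}" using m by (auto simp: A_def)
  ultimately have "Inf A \<in> A" using closed_contains_Inf by blast
  define u where "u = Inf A"
  have u: "0 \<le> u" "u \<le> D" "g u = g m" using \<open>Inf A \<in> A\<close> by (auto simp: u_def A_def)
  have gm: "g m = 0"
  proof (cases "u = 0 \<or> u = D")
    case True then show ?thesis using u g0 by auto
  next
    case False
    define d where "d = min u (D - u)"
    have d: "d > 0" "0 \<le> u - d" "u + d \<le> D" using False u by (auto simp: d_def)
    have "u - d \<notin> A" using cInf_lower[OF _ bdd, of "u - d"] d by (auto simp: u_def)
    then have less: "g (u - d) < g m" using m(2)[of "u - d"] d u by (fastforce simp: A_def)
    have "f u \<le> (f (u - d) + f (u + d)) / 2" using mid[of "u - d" "u + d"] d by simp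
    then have "g u \<le> (g (u - d) + g (u + d)) / 2"
      by (simp add: g_def field_simps)
    also have "\<dots> < g m" using less m(2)[of "u + d"] d u by simp
    finally show ?thesis using u by simp
  qed
  have "(1 - t / D) * f 0 + t / D * f D = f 0 + t * k"
    using D by (simp add: k_def field_simps)
  then show ?thesis using m(2)[of t] t gm by (simp add: g_def)
qed

section \<open>Busemann functions of rays in metric spaces\<close>

text \<open>Along a ray \<open>dist z (c t) - t\<close> is nonincreasing in \<open>t\<close>, so
  this infimum is the usual limit at infinity. With this sign the function tends to minus infinity
  towards the end of the ray.\<close>

definition busemann :: "(real \<Rightarrow> 'a::metric_space) \<Rightarrow> 'a \<Rightarrow> real" where
  "busemann c z = (INF t\<in>{0..}. dist z (c t) - t)"

lemma busemann_le:
  assumes c: "geodesic_ray c" and t: "t \<ge> 0"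
  shows "busemann c z \<le> dist z (c t) - t"
  unfolding busemann_def
proof (rule cINF_lower)
  have "- dist z (c 0) \<le> dist z (c s) - s" if "s \<ge> 0" for s
    using c that dist_triangle[of "c 0" "c s" z] by (simp add: geodesic_ray_def dist_commute)
  then show "bdd_below ((\<lambda>t. dist z (c t) - t) ` {0..})"
    by (intro bdd_belowI2[of _ "- dist z (c 0)"]) auto
qed (use t in auto)

lemma tendsto_busemann:
  assumes c: "geodesic_ray c"
  shows "((\<lambda>t. dist z (c t) - t) \<longlongrightarrow> busemann c z) at_top"
proof (rule order_tendstoI)
  fix a assume "a < busemann c z"
  then show "\<forall>\<^sub>F t in at_top. a < dist z (c t) - t"
    using busemann_le[OF c] by (intro eventually_mono[OF eventually_ge_at_top[of 0]]) (meson less_le_trans)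
next
  fix a assume a: "busemann c z < a"
  have "\<not> (\<forall>s\<ge>0. a \<le> dist z (c s) - s)"
  proof
    assume "\<forall>s\<ge>0. a \<le> dist z (c s) - s"
    then have "a \<le> busemann c z" unfolding busemann_def by (intro cINF_greatest) auto
    then show False using a by simp
  qed
  then obtain s where s: "s \<ge> 0" "dist z (c s) - s < a" by force
  show "\<forall>\<^sub>F t in at_top. dist z (c t) - t < a"
  proof (rule eventually_mono[OF eventually_ge_at_top[of s]])
    fix t assume "s \<le> t"
    then show "dist z (c t) - t < a"
      using s c dist_triangle[of z "c t" "c s"] by (simp add: geodesic_ray_def)
  qed
qed

lemma busemann_lipschitz:
  assumes c: "geodesic_ray c"
  shows "busemann c z \<le> busemann c w + dist z w"
proof (rule tendsto_le[OF _ tendsto_add[OF tendsto_busemann[OF c, of w] tendsto_const] tendsto_busemann[OF c, of z]])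
  show "\<forall>\<^sub>F t in at_top. dist z (c t) - t \<le> dist w (c t) - t + dist z w"
    by (intro always_eventually) (simp add: dist_triangle algebra_simps)
qed simp

lemma busemann_comp_isometry:
  assumes "isometry f"
  shows "busemann (f \<circ> c) (f z) = busemann c z"
  using assms by (simp add: busemann_def isometry_def)

lemma busemann_asymptotic_bound:
  assumes "(c, c') \<in> asymptotic"
  obtains B where "\<And>z. busemann c z \<le> busemann c' z + B"
proof -
  from assms obtain B where c: "geodesic_ray c" "geodesic_ray c'"
    and B: "\<And>t. t \<ge> 0 \<Longrightarrow> dist (c t) (c' t) \<le> B"
    by (auto simp: asymptotic_def)
  have "busemann c z \<le> busemann c' z + B" for z
  proof (rule tendsto_le[OF _ tendsto_add[OF tendsto_busemann[OF c(2)] tendsto_const] tendsto_busemann[OF c(1)]])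
    show "\<forall>\<^sub>F t in at_top. dist z (c t) - t \<le> dist z (c' t) - t + B"
    proof (rule eventually_mono[OF eventually_ge_at_top[of 0]])
      fix t :: real assume "0 \<le> t"
      then show "dist z (c t) - t \<le> dist z (c' t) - t + B"
        using B[of t] dist_triangle[of z "c t" "c' t"] by (simp add: dist_commute)
    qed
  qed simp
  then show thesis by (rule that)
qed

lemma busemann_line_sum_nonneg:
  assumes "geodesic_line c"
  shows "0 \<le> busemann (\<lambda>t. c (- t)) z + busemann c z"
proof -
  have c: "geodesic_ray c" "geodesic_ray (\<lambda>t. c (- t))"
    using assms by (auto simp: geodesic_line_def geodesic_ray_def)
  show ?thesis
  proof (rule tendsto_le[OF _ tendsto_add[OF tendsto_busemann[OF c(2)] tendsto_busemann[OF c(1)]] tendsto_const])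
    show "\<forall>\<^sub>F t in at_top. 0 \<le> dist z (c (- t)) - t + (dist z (c t) - t)"
    proof (rule eventually_mono[OF eventually_ge_at_top[of 0]])
      fix t :: real assume "0 \<le> t"
      moreover have "dist (c (- t)) (c t) = \<bar>- t - t\<bar>"
        using assms unfolding geodesic_line_def by blast
      ultimately show "0 \<le> dist z (c (- t)) - t + (dist z (c t) - t)"
        using dist_triangle[of "c (- t)" "c t" z] by (simp add: dist_commute)
    qed
  qed simp
qed

section \<open>Asymptotic rays and points at infinity\<close>

lemma asymptotic_sym: "(c, c') \<in> asymptotic \<Longrightarrow> (c', c) \<in> asymptotic"
  using equiv_asymptotic by (auto elim: equivE dest: symD)

lemma ray_end_eq_iff:
  assumes "geodesic_ray c" "geodesic_ray c'"
  shows "ray_end c = ray_end c' \<longleftrightarrow> (c, c') \<in> asymptotic"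
  unfolding ray_end_def using eq_equiv_class_iff[OF equiv_asymptotic] assms by blast

lemma geodesic_ray_comp_isometry:
  "isometry f \<Longrightarrow> geodesic_ray c \<Longrightarrow> geodesic_ray (f \<circ> c)"
  by (simp add: isometry_def geodesic_ray_def)

lemma ray_end_in_boundary: "geodesic_ray c \<Longrightarrow> ray_end c \<in> boundary_at_infinity"
  by (auto simp: ray_end_def boundary_at_infinity_def intro: quotientI)

lemma boundary_pointE:
  assumes "\<xi> \<in> boundary_at_infinity"
  obtains c where "geodesic_ray c" "\<xi> = ray_end c"
  using assms by (auto simp: boundary_at_infinity_def ray_end_def elim: quotientE)

lemma ray_end_in_boundary_fix_iff:
  assumes "isometry f" "geodesic_ray c"
  shows "ray_end c \<in> boundary_fix f \<longleftrightarrow> (f \<circ> c, c) \<in> asymptotic"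
  using assms by (simp add: boundary_fix_def ray_end_in_boundary boundary_action_ray_end
      ray_end_eq_iff geodesic_ray_comp_isometry)

section \<open>Paths that approach their endpoint steadily\<close>

text \<open>For the maximiser \<open>i\<close> of \<open>dist (P i) (P n) + e * i\<close>,
  comparison with index 0 leaves a distance of at least \<open>e * k\<close> to go, and comparison
  with \<open>i + j\<close> gives the speed \<open>e\<close>. Steps of length at most
  \<open>C\<close> need at least \<open>e * k / C\<close> further indices to cover that distance,
  whence the range of \<open>j\<close>.\<close>

lemma exists_steady_start:
  fixes P :: "nat \<Rightarrow> 'a::metric_space"
  assumes step: "\<And>j. j < n \<Longrightarrow> dist (P j) (P (Suc j)) \<le> C"
    and n: "real n \<le> k" and far: "2 * e * k \<le> dist (P 0) (P n)" and e: "e > 0" and C: "C > 0"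
  obtains i where "i \<le> n" "e * k \<le> dist (P i) (P n)"
    "\<And>j. real j * C \<le> e * k \<Longrightarrow> i + j \<le> n"
    "\<And>j. real j * C \<le> e * k \<Longrightarrow> dist (P i) (P (i + j)) \<le> C * j"
    "\<And>j. real j * C \<le> e * k \<Longrightarrow> dist (P (i + j)) (P n) + e * j \<le> dist (P i) (P n)"
proof -
  define F where "F i = dist (P i) (P n) + e * real i" for i
  have "Max (F ` {..n}) \<in> F ` {..n}" by (rule Max_in) auto
  then obtain i where i: "i \<le> n" "F i = Max (F ` {..n})" by (metis atMost_iff imageE)
  then have max: "F j \<le> F i" if "j \<le> n" for j using that by simp
  have "e * real i \<le> e * k" using i n e by simp
  then have far_i: "e * k \<le> dist (P i) (P n)" using max[of 0] far by (simp add: F_def)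
  have len: "dist (P i) (P (i + l)) \<le> C * real l" if "i + l \<le> n" for l
    using that
  proof (induction l)
    case (Suc l)
    then show ?case
      using step[of "i + l"] dist_triangle[of "P i" "P (i + Suc l)" "P (i + l)"] by (simp add: algebra_simps)
  qed simp
  have j: "i + j \<le> n" if "real j * C \<le> e * k" for j
  proof -
    have "C * real j \<le> C * real (n - i)" using that far_i len[of "n - i"] i by (simp add: mult.commute)
    then have "j \<le> n - i" using C by simp
    then show ?thesis using i by simp
  qed
  show thesis
    by (rule that[OF i(1) far_i j len[OF j]]) (use max j in \<open>force simp: F_def algebra_simps\<close>)+
qed

section \<open>Comparison inequalities in CAT(0) spaces\<close>

context
  assumes cat0: "cat0_space TYPE('a::metric_space)"
begin

lemma exists_geodesic_segment: "\<exists>c. geodesic_segment c (x::'a) y"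
  using cat0 by (auto simp: cat0_space_def)

lemma CN_inequality:
  assumes "geodesic_segment c (x::'a) y"
  shows "(dist z (c (dist x y / 2)))\<^sup>2 \<le> 1/2 * ((dist z x)\<^sup>2 + (dist z y)\<^sup>2) - 1/4 * (dist x y)\<^sup>2"
  using cat0 assms by (auto simp: cat0_space_def)

text \<open>The quadrilateral inequality: diagonals against sides. It follows from the CN inequality
  at the midpoint of the diagonal from \<open>p\<close> to \<open>u\<close>, seen from
  \<open>q\<close> and from \<open>v\<close>.\<close>

lemma four_point_inequality:
  fixes p u q v :: 'a
  shows "(dist p u)\<^sup>2 + (dist q v)\<^sup>2 \<le> (dist p q)\<^sup>2 + (dist q u)\<^sup>2 + (dist u v)\<^sup>2 + (dist v p)\<^sup>2"
proof -
  obtain c where c: "geodesic_segment c p u" using exists_geodesic_segment by blast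
  define m where "m = c (dist p u / 2)"
  have "(dist q v)\<^sup>2 \<le> (dist q m + dist v m)\<^sup>2"
    by (simp add: dist_triangle2 power_mono)
  also have "\<dots> \<le> 2 * (dist q m)\<^sup>2 + 2 * (dist v m)\<^sup>2"
    using sum_squares_bound[of "dist q m" "dist v m"] by (simp add: power2_sum)
  finally show ?thesis
    using CN_inequality[OF c, of q] CN_inequality[OF c, of v]
    by (simp add: m_def[symmetric] dist_commute algebra_simps)
qed

lemma midpoint_CN:
  assumes c: "\<And>s t. s \<in> {0..D} \<Longrightarrow> t \<in> {0..D} \<Longrightarrow> dist (c s) (c t :: 'a) = \<bar>s - t\<bar>"
    and st: "0 \<le> s" "s \<le> t" "t \<le> D"
  shows "(dist z (c ((s + t) / 2)))\<^sup>2 \<le> 1/2 * ((dist z (c s))\<^sup>2 + (dist z (c t))\<^sup>2) - 1/4 * (t - s)\<^sup>2"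
proof -
  have d: "dist (c s) (c t) = t - s" using c[of s t] st by simp
  have "geodesic_segment (\<lambda>r. c (s + r)) (c s) (c t)"
    unfolding geodesic_segment_def d using st by (auto simp: c)
  from CN_inequality[OF this, of z] show ?thesis
    unfolding d by (simp add: field_simps)
qed

text \<open>The diagonal from \<open>c' s\<close> to \<open>c t\<close> cuts the quadrilateral into
  two triangles. Its midpoint is joined to the other two midpoints by a midline of each.\<close>

lemma dist_midpoints_le:
  assumes c: "\<And>s t. s \<in> {0..D} \<Longrightarrow> t \<in> {0..D} \<Longrightarrow> dist (c s) (c t :: 'a) = \<bar>s - t\<bar>"
    and c': "\<And>s t. s \<in> {0..D} \<Longrightarrow> t \<in> {0..D} \<Longrightarrow> dist (c' s) (c' t :: 'a) = \<bar>s - t\<bar>"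
    and st: "0 \<le> s" "s \<le> t" "t \<le> D"
  shows "dist (c ((s + t) / 2)) (c' ((s + t) / 2)) \<le> (dist (c s) (c' s) + dist (c t) (c' t)) / 2"
proof -
  \<comment> \<open>The midline estimate: in two uses of the CN inequality the terms in
    \<open>dist x y\<close> and \<open>dist z y\<close> cancel.\<close>
  have triangle: "dist (a (dist x y / 2)) (b (dist z y / 2)) \<le> dist x z / 2"
    if a: "geodesic_segment a x y" and b: "geodesic_segment b z y" for a b and x y z :: 'a
  proof -
    have ay: "dist (a (dist x y / 2)) y = dist x y / 2"
      using a unfolding geodesic_segment_def
      by (smt (verit, best) atLeastAtMost_iff field_sum_of_halves zero_le_dist)
    have "(dist (a (dist x y / 2)) (b (dist z y / 2)))\<^sup>2 \<le> (dist x z / 2)\<^sup>2"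
      using CN_inequality[OF b, of "a (dist x y / 2)"] CN_inequality[OF a, of z]
      unfolding ay by (simp add: dist_commute field_simps power2_eq_square)
    then show ?thesis by (rule power2_le_imp_le) simp
  qed
  have d: "dist (c s) (c t) = t - s" "dist (c' s) (c' t) = t - s" using c[of s t] c'[of s t] st by simp_all
  have g: "geodesic_segment (\<lambda>r. c (s + r)) (c s) (c t)"
    unfolding geodesic_segment_def d using st by (auto simp: c)
  \<comment> \<open>Both sides in \<open>triangle\<close> end at the shared vertex, so
    \<open>c'\<close> is reversed here, and the diagonal is reversed for the second
    triangle.\<close>
  have g': "geodesic_segment (\<lambda>r. c' (t - r)) (c' t) (c' s)"
    unfolding geodesic_segment_def dist_commute[of "c' t"] d using st by (auto simp: c')
  obtain e where e: "geodesic_segment e (c' s) (c t)" using exists_geodesic_segment by blast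
  have e': "geodesic_segment (\<lambda>r. e (dist (c' s) (c t) - r)) (c t) (c' s)"
    using e unfolding geodesic_segment_def dist_commute[of "c t"] by auto
  have "dist (c ((s + t) / 2)) (e (dist (c' s) (c t) / 2)) \<le> dist (c s) (c' s) / 2"
    using triangle[OF g e] unfolding d by (simp add: field_simps)
  moreover have "dist (e (dist (c' s) (c t) / 2)) (c' ((s + t) / 2)) \<le> dist (c t) (c' t) / 2"
    using triangle[OF e' g'] unfolding dist_commute[of "c' t"] d dist_commute[of "c t" "c' s"]
    by (simp add: field_simps)
  ultimately show ?thesis
    using dist_triangle[of "c ((s + t) / 2)" "c' ((s + t) / 2)" "e (dist (c' s) (c t) / 2)"] by simp
qed

text \<open>For \<open>c' = f \<circ> c\<close> this bounds the displacement of an isometry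
  \<open>f\<close> along a segment by its displacement at the two ends.\<close>

lemma dist_geodesics_le:
  assumes c: "\<And>s t. s \<in> {0..D} \<Longrightarrow> t \<in> {0..D} \<Longrightarrow> dist (c s) (c t :: 'a) = \<bar>s - t\<bar>"
    and c': "\<And>s t. s \<in> {0..D} \<Longrightarrow> t \<in> {0..D} \<Longrightarrow> dist (c' s) (c' t :: 'a) = \<bar>s - t\<bar>"
    and t: "0 \<le> t" "t \<le> D" and D: "D > 0"
  shows "dist (c t) (c' t) \<le> max (dist (c 0) (c' 0)) (dist (c D) (c' D))"
proof -
  have cc: "continuous_on {0..D} c" "continuous_on {0..D} c'"
    by (rule continuous_onI, use c c' in \<open>auto simp: dist_real_def\<close>)+
  have "dist (c t) (c' t) \<le> (1 - t / D) * dist (c 0) (c' 0) + t / D * dist (c D) (c' D)"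
    by (rule midpoint_convex_le_chord[where f = "\<lambda>t. dist (c t) (c' t)"])
      (use dist_midpoints_le[OF c c'] t D cc in \<open>auto intro!: continuous_intros\<close>)
  also have "\<dots> \<le> max (dist (c 0) (c' 0)) (dist (c D) (c' D))"
    by (rule convex_bound_le) (use t D in auto)
  finally show ?thesis .
qed

text \<open>The triangle inequality gives \<open>dist z (c D) - D \<le> dist z (c t) - t\<close>. Convexity of
  \<open>t \<mapsto> (dist z (c t))\<^sup>2 - t\<^sup>2\<close> gives this converse, up to an error that is independent of \<open>D\<close>.\<close>

lemma dist_geodesic_diff_le:
  assumes c: "\<And>s t. s \<in> {0..D} \<Longrightarrow> t \<in> {0..D} \<Longrightarrow> dist (c s) (c t :: 'a) = \<bar>s - t\<bar>"
    and r: "dist z (c 0) \<le> r" and t: "r < t" "t \<le> D"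
  shows "dist z (c t) - t \<le> dist z (c D) - D + r\<^sup>2 / (2 * (t - r))"
proof -
  have r0: "r \<ge> 0" using r zero_le_dist order_trans by blast
  have D: "D > 0" using t r0 by simp
  have cc: "continuous_on {0..D} c"
    by (rule continuous_onI, use c in \<open>auto simp: dist_real_def\<close>)
  define h where "h = dist z (c D) - D"
  have d0: "dist (c 0) (c D) = D" using c[of 0 D] D by simp
  have h: "- r \<le> h" "h \<le> r"
    using dist_triangle[of "c 0" "c D" z] dist_triangle[of z "c D" "c 0"] r d0
    by (auto simp: h_def dist_commute)
  have "(dist z (c t))\<^sup>2 - t\<^sup>2 \<le> (1 - t / D) * ((dist z (c 0))\<^sup>2 - 0\<^sup>2) + t / D * ((dist z (c D))\<^sup>2 - D\<^sup>2)"
  proof (rule midpoint_convex_le_chord[where f = "\<lambda>t. (dist z (c t))\<^sup>2 - t\<^sup>2"])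
    fix s u assume su: "0 \<le> s" "s \<le> u" "u \<le> D"
    show "(dist z (c ((s + u) / 2)))\<^sup>2 - ((s + u) / 2)\<^sup>2 \<le> ((dist z (c s))\<^sup>2 - s\<^sup>2 + ((dist z (c u))\<^sup>2 - u\<^sup>2)) / 2"
      using midpoint_CN[OF c su, of z] by (simp add: field_simps power2_eq_square)
  qed (use t r0 D cc in \<open>auto intro!: continuous_intros\<close>)
  \<comment> \<open>Estimating the start value and the quadratic part of the end value by the same
    \<open>r\<^sup>2\<close> makes the weights add up to 1, so \<open>D\<close> drops out of the
    error.\<close>
  also have "(1 - t / D) * ((dist z (c 0))\<^sup>2 - 0\<^sup>2) \<le> (1 - t / D) * r\<^sup>2"
    using r t D by (intro mult_left_mono) (auto intro!: power_mono)
  also have "t / D * ((dist z (c D))\<^sup>2 - D\<^sup>2) = 2 * t * h + t / D * h\<^sup>2"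
    using D by (simp add: h_def field_simps power2_eq_square)
  also have "t / D * h\<^sup>2 \<le> t / D * r\<^sup>2"
    using h r0 t D by (intro mult_left_mono) (auto simp: abs_le_square_iff[symmetric])
  finally have "(dist z (c t))\<^sup>2 \<le> t\<^sup>2 + 2 * t * h + r\<^sup>2" by (simp add: algebra_simps)
  also have "\<dots> \<le> (t + h + r\<^sup>2 / (2 * (t - r)))\<^sup>2"
  proof -
    \<comment> \<open>The error is chosen so that \<open>2 * (t - r) * e = r\<^sup>2\<close>; as
      \<open>h \<ge> - r\<close>, the mixed term \<open>2 * (t + h) * e\<close> of the square
      absorbs \<open>r\<^sup>2\<close>.\<close>
    define e where "e = r\<^sup>2 / (2 * (t - r))"
    have e: "e \<ge> 0" "2 * (t - r) * e = r\<^sup>2" using t by (auto simp: e_def)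
    have "r\<^sup>2 \<le> 2 * (t + h) * e"
      unfolding e(2)[symmetric] using e h by (intro mult_right_mono) auto
    moreover have "(t + h + e)\<^sup>2 = t\<^sup>2 + 2 * t * h + 2 * (t + h) * e + (h\<^sup>2 + e\<^sup>2)"
      by (simp add: power2_eq_square algebra_simps)
    moreover have "0 \<le> h\<^sup>2 + e\<^sup>2" by simp
    ultimately show ?thesis unfolding e_def[symmetric] by linarith
  qed
  finally have "dist z (c t) \<le> t + h + r\<^sup>2 / (2 * (t - r))"
    by (rule power2_le_imp_le) (use h t in auto)
  then show ?thesis by (simp add: h_def)
qed

section \<open>Busemann functions of asymptotic rays\<close>

text \<open>The four-point inequality for \<open>p\<close>, \<open>c t\<close>, \<open>q\<close>,
  \<open>c' t\<close> bounds the difference of differences of squared distances independently of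
  \<open>t\<close>. Divided by \<open>t\<close>, the bound vanishes in the limit and the differences
  of squares become twice the Busemann differences.\<close>

lemma busemann_diff_le:
  fixes p q :: 'a
  assumes "(c, c') \<in> asymptotic"
  shows "busemann c p - busemann c q \<le> busemann c' p - busemann c' q"
proof -
  from assms obtain B where c: "geodesic_ray c" and c': "geodesic_ray c'"
    and B: "\<And>t. t \<ge> 0 \<Longrightarrow> dist (c t) (c' t) \<le> B"
    by (auto simp: asymptotic_def)
  have sum: "((\<lambda>t. (dist p (b t) + dist q (b t)) / t) \<longlongrightarrow> 2) at_top" if b: "geodesic_ray b" for b
  proof -
    have inv0: "((\<lambda>t::real. 1 / t) \<longlongrightarrow> 0) at_top"
      using tendsto_inverse_0_at_top[OF filterlim_ident] by (simp add: inverse_eq_divide)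
    have "((\<lambda>t. ((dist p (b t) - t) + (dist q (b t) - t)) * (1 / t) + 2)
        \<longlongrightarrow> (busemann b p + busemann b q) * 0 + 2) at_top"
      by (intro tendsto_intros tendsto_busemann b inv0)
    then show ?thesis
      by (rule filterlim_cong[THEN iffD1, rotated 3])
        (auto intro!: eventually_mono[OF eventually_gt_at_top[of 0]] simp: field_simps)
  qed
  \<comment> \<open>A difference of squares over \<open>t\<close>, factored so that both factors
    converge; the second tends to 2.\<close>
  define G where "G b t = ((dist p (b t) - t) - (dist q (b t) - t)) * ((dist p (b t) + dist q (b t)) / t)"
    for b :: "real \<Rightarrow> 'a" and t
  have G: "(G b \<longlongrightarrow> (busemann b p - busemann b q) * 2) at_top" if b: "geodesic_ray b" for b
    unfolding G_def by (intro tendsto_intros tendsto_busemann sum b)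
  have "((\<lambda>t. ((dist p q)\<^sup>2 + B\<^sup>2) / t) \<longlongrightarrow> 0) at_top"
    by (intro tendsto_divide_0[OF tendsto_const] filterlim_at_top_imp_at_infinity filterlim_ident)
  then have "(busemann c p - busemann c q) * 2 - (busemann c' p - busemann c' q) * 2 \<le> 0"
  proof (rule tendsto_le[OF _ _ tendsto_diff[OF G[OF c] G[OF c']], rotated])
    show "\<forall>\<^sub>F t in at_top. G c t - G c' t \<le> ((dist p q)\<^sup>2 + B\<^sup>2) / t"
    proof (rule eventually_mono[OF eventually_gt_at_top[of 0]])
      fix t :: real assume t: "t > 0"
      have "(dist (c t) (c' t))\<^sup>2 \<le> B\<^sup>2" using B[of t] t by (intro power_mono) auto
      then have "((dist p (c t))\<^sup>2 - (dist q (c t))\<^sup>2) - ((dist p (c' t))\<^sup>2 - (dist q (c' t))\<^sup>2)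
          \<le> (dist p q)\<^sup>2 + B\<^sup>2"
        using four_point_inequality[of p "c t" q "c' t"] by (simp add: dist_commute)
      then have "(((dist p (c t))\<^sup>2 - (dist q (c t))\<^sup>2) - ((dist p (c' t))\<^sup>2 - (dist q (c' t))\<^sup>2)) / t
          \<le> ((dist p q)\<^sup>2 + B\<^sup>2) / t"
        using t by (intro divide_right_mono) auto
      moreover have "G b t = ((dist p (b t))\<^sup>2 - (dist q (b t))\<^sup>2) / t" for b
        by (simp add: G_def power2_eq_square algebra_simps)
      ultimately show "G c t - G c' t \<le> ((dist p q)\<^sup>2 + B\<^sup>2) / t"
        by (simp add: diff_divide_distrib)
    qed
  qed simp
  then show ?thesis by simp
qed

lemma busemann_diff_eq:
  fixes p q :: 'a
  assumes "(c, c') \<in> asymptotic"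
  shows "busemann c p - busemann c q = busemann c' p - busemann c' q"
  using busemann_diff_le[OF assms] busemann_diff_le[OF asymptotic_sym[OF assms]] by (meson antisym)

section \<open>Limit rays in proper CAT(0) spaces\<close>

context
  assumes proper: "proper_space TYPE('a)"
begin

text \<open>Tychonoff's theorem for a product of closed balls, one for each time, provides a cluster
  point of the segments. An uncountable product need not be sequentially compact, so convergence is
  along a filter finer than \<open>sequentially\<close>, not along a subsequence.\<close>

lemma exists_limit_ray:
  fixes x :: 'a and y :: "nat \<Rightarrow> 'a"
  assumes y: "filterlim (\<lambda>m. dist x (y m)) at_top sequentially"
    and c: "\<And>m. geodesic_segment (c m) x (y m)"
  obtains \<gamma> F where "geodesic_ray \<gamma>" "\<gamma> 0 = x" "F \<noteq> bot" "F \<le> sequentially"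
    "\<And>t. t \<ge> 0 \<Longrightarrow> ((\<lambda>m. c m t) \<longlongrightarrow> \<gamma> t) F"
proof -
  \<comment> \<open>Outside its segment \<open>c m\<close> is arbitrary; the default value
    \<open>x\<close> keeps all of \<open>b m\<close> in the product of balls.\<close>
  define b where "b m t = (if t \<in> {0..dist x (y m)} then c m t else x)" for m t
  define K where "K = Pi\<^sub>E UNIV (\<lambda>t::real. cball x \<bar>t\<bar>)"
  have "compact (cball x r)" for r
    using proper by (simp add: proper_space_def)
  then have "compactin (product_topology (\<lambda>t. euclidean) UNIV) K"
    unfolding K_def compactin_PiE by simp
  then have K: "compact K" by (simp add: euclidean_product_topology)
  have bK: "b m \<in> K" for m
  proof -
    have "dist x (b m t) \<le> \<bar>t\<bar>" for t
      using c[of m] unfolding geodesic_segment_def b_def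
      by (smt (verit) atLeastAtMost_iff dist_self)
    then show ?thesis by (auto simp: K_def)
  qed
  then obtain \<gamma> where \<gamma>: "inf (nhds \<gamma>) (filtermap b sequentially) \<noteq> bot"
    using K[unfolded compact_filter, rule_format, of "filtermap b sequentially"]
    by (auto simp: filtermap_bot_iff eventually_filtermap)
  define F where "F = inf sequentially (filtercomap b (nhds \<gamma>))"
  have F: "F \<noteq> bot"
  proof
    assume "F = bot"
    then obtain P Q where PQ: "eventually P sequentially" "eventually Q (nhds \<gamma>)" "\<And>m. P m \<Longrightarrow> \<not> Q (b m)"
      unfolding F_def trivial_limit_def eventually_inf eventually_filtercomap by blast
    have "eventually (\<lambda>g. \<not> Q g) (filtermap b sequentially)"
      using PQ by (auto simp: eventually_filtermap elim: eventually_mono)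
    with PQ(2) have "inf (nhds \<gamma>) (filtermap b sequentially) = bot"
      unfolding trivial_limit_def eventually_inf by blast
    with \<gamma> show False by simp
  qed
  have le: "F \<le> sequentially" by (simp add: F_def)
  have "filterlim b (nhds \<gamma>) F"
    by (simp add: F_def filterlim_iff_le_filtercomap)
  then have lim_b: "((\<lambda>m. b m t) \<longlongrightarrow> \<gamma> t) F" for t
    using continuous_on_tendsto_compose[OF continuous_on_product_coordinates, of b \<gamma> F t] by simp
  have ev: "\<forall>\<^sub>F m in F. t \<le> dist x (y m)" for t
    using y le by (auto simp: filterlim_at_top intro: filter_leD)
  have lim: "((\<lambda>m. c m t) \<longlongrightarrow> \<gamma> t) F" if "t \<ge> 0" for t
    using lim_b[of t] by (rule filterlim_cong[THEN iffD1, rotated 3])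
      (use that in \<open>auto simp: b_def intro!: eventually_mono[OF ev[of t]]\<close>)
  have "dist (\<gamma> s) (\<gamma> t) = \<bar>s - t\<bar>" if "s \<ge> 0" "t \<ge> 0" for s t
  proof (rule tendsto_unique[OF F tendsto_dist[OF lim lim]])
    show "((\<lambda>m. dist (c m s) (c m t)) \<longlongrightarrow> \<bar>s - t\<bar>) F"
      by (rule tendsto_eventually, rule eventually_mono[OF ev[of "max s t"]])
        (use c that in \<open>auto simp: geodesic_segment_def\<close>)
  qed (use that in auto)
  moreover have "\<gamma> 0 = x"
    using c by (intro tendsto_unique[OF F lim]) (auto simp: geodesic_segment_def)
  ultimately show thesis
    using F le lim by (intro that[of \<gamma> F]) (auto simp: geodesic_ray_def)
qed

text \<open>\<open>Q m\<close> is thought of as a path from \<open>x\<close> towards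
  \<open>y m\<close>. By \<open>dist_geodesic_diff_le\<close>, the distance to \<open>y m\<close> is
  comparable with the distance to a point at a fixed time \<open>t\<close> of the segment, hence
  with that to the limit ray. The bound \<open>R j\<close> is uniform in \<open>m\<close>, so
  \<open>t\<close> can be fixed before \<open>m\<close>.\<close>

lemma exists_drift_ray:
  fixes x :: 'a and y :: "nat \<Rightarrow> 'a" and Q :: "nat \<Rightarrow> nat \<Rightarrow> 'a"
  assumes e: "e > 0"
    and y: "\<And>m. e * real m \<le> dist x (y m)"
    and Q: "\<And>m j. real j * C \<le> e * real m \<Longrightarrow> dist (Q m j) (y m) + e * real j \<le> dist x (y m)"
    and Q_bounded: "\<And>m j. real j * C \<le> e * real m \<Longrightarrow> dist x (Q m j) \<le> R j"
  obtains \<gamma> where "geodesic_ray \<gamma>"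
    "\<forall>j. \<exists>m. real j * C \<le> e * real m \<and> busemann \<gamma> (Q m j) \<le> 1 - e * real j"
    "\<forall>f L. isometry f \<longrightarrow> (\<forall>m. dist (y m) (f (y m)) \<le> L) \<longrightarrow> (f \<circ> \<gamma>, \<gamma>) \<in> asymptotic"
proof -
  have em: "filterlim (\<lambda>m. e * real m) at_top sequentially"
    by (intro filterlim_tendsto_pos_mult_at_top[OF tendsto_const] e filterlim_real_sequentially)
  then have y_top: "filterlim (\<lambda>m. dist x (y m)) at_top sequentially"
    by (rule filterlim_at_top_mono) (use y in auto)
  have "\<forall>m. \<exists>c. geodesic_segment c x (y m)" using exists_geodesic_segment by blast
  from choice[OF this] obtain c where c: "\<And>m. geodesic_segment (c m) x (y m)" by blast
  obtain \<gamma> F where \<gamma>: "geodesic_ray \<gamma>" "\<gamma> 0 = x" and F: "F \<noteq> bot" "F \<le> sequentially"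
    and lim: "\<And>t. t \<ge> 0 \<Longrightarrow> ((\<lambda>m. c m t) \<longlongrightarrow> \<gamma> t) F"
    using exists_limit_ray[OF y_top c] by metis
  have ev: "\<forall>\<^sub>F m in F. t \<le> dist x (y m)" "\<forall>\<^sub>F m in F. t \<le> e * real m" for t
    using y_top em F(2) by (auto simp: filterlim_at_top intro: filter_leD)
  have geo: "dist (c m s) (c m t) = \<bar>s - t\<bar>" if "s \<in> {0..dist x (y m)}" "t \<in> {0..dist x (y m)}" for m s t
    using c that unfolding geodesic_segment_def by blast
  have c0: "c m 0 = x" and c1: "c m (dist x (y m)) = y m" for m
    using c unfolding geodesic_segment_def by blast+
  show thesis
  proof (rule that[OF \<gamma>(1)])
    show "\<forall>j. \<exists>m. real j * C \<le> e * real m \<and> busemann \<gamma> (Q m j) \<le> 1 - e * real j"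
    proof
      fix j
      \<comment> \<open>With \<open>t = r + r\<^sup>2\<close> the error
        \<open>r\<^sup>2 / (2 * (t - r))\<close> is \<open>1 / 2\<close>; replacing
        \<open>c m t\<close> by \<open>\<gamma> t\<close> costs the other half of the final
        1.\<close>
      define r where "r = max (R j) 1"
      define t where "t = r + r\<^sup>2"
      have r: "r \<ge> 1" "R j \<le> r" by (auto simp: r_def)
      have t: "r < t" "0 \<le> t" using r by (auto simp: t_def)
      have "\<forall>\<^sub>F m in F. dist (c m t) (\<gamma> t) < 1 / 2"
        using tendstoD[OF lim[OF t(2)], of "1 / 2"] by simp
      with ev(1)[of t] ev(2)[of "real j * C"]
      have "\<forall>\<^sub>F m in F. real j * C \<le> e * real m \<and> busemann \<gamma> (Q m j) \<le> 1 - e * real j"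
      proof eventually_elim
        case (elim m)
        have "dist (Q m j) (c m t) - t \<le> dist (Q m j) (c m (dist x (y m))) - dist x (y m) + r\<^sup>2 / (2 * (t - r))"
          by (rule dist_geodesic_diff_le[OF geo])
            (use t Q_bounded[OF elim(2)] r elim(1) c0 in \<open>auto simp: dist_commute\<close>)
        also have "r\<^sup>2 / (2 * (t - r)) = 1 / 2" using r by (simp add: t_def)
        finally have "dist (Q m j) (c m t) - t \<le> 1 / 2 - e * real j"
          using Q[OF elim(2)] by (simp add: c1)
        moreover have "busemann \<gamma> (Q m j) \<le> dist (Q m j) (\<gamma> t) - t"
          by (rule busemann_le[OF \<gamma>(1) t(2)])
        ultimately show ?case
          using dist_triangle[of "Q m j" "\<gamma> t" "c m t"] elim by simp
      qed
      then show "\<exists>m. real j * C \<le> e * real m \<and> busemann \<gamma> (Q m j) \<le> 1 - e * real j"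
        using eventually_happens'[OF F(1)] by blast
    qed
  next
    have "(f \<circ> \<gamma>, \<gamma>) \<in> asymptotic" if f: "isometry f" and L: "\<forall>m. dist (y m) (f (y m)) \<le> L" for f L
    proof -
      have df: "dist (f p) (f q) = dist p q" for p q using f by (simp add: isometry_def)
      have "dist (f (\<gamma> t)) (\<gamma> t) \<le> max (dist x (f x)) L" if t: "t \<ge> 0" for t
      proof (rule tendsto_upperbound[OF tendsto_dist[OF _ lim[OF t]] _ F(1)])
        have "continuous_on UNIV f" by (rule continuous_onI) (auto simp: df)
        then show "((\<lambda>m. f (c m t)) \<longlongrightarrow> f (\<gamma> t)) F"
          using lim[OF t] by (rule continuous_on_tendsto_compose) auto
        show "\<forall>\<^sub>F m in F. dist (f (c m t)) (c m t) \<le> max (dist x (f x)) L"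
          \<comment> \<open>The extra 1 makes the segment have positive length even for
            \<open>t = 0\<close>.\<close>
          using ev(1)[of "t + 1"]
        proof eventually_elim
          case (elim m)
          have "dist (c m t) (f (c m t)) \<le> max (dist (c m 0) (f (c m 0))) (dist (c m (dist x (y m))) (f (c m (dist x (y m)))))"
            by (rule dist_geodesics_le[where c' = "\<lambda>t. f (c m t)"]) (use geo df t elim in auto)
          then show ?case using L[rule_format, of m] by (simp add: c0 c1 dist_commute)
        qed
      qed
      then show ?thesis
        using \<gamma>(1) geodesic_ray_comp_isometry[OF f \<gamma>(1)] by (auto simp: asymptotic_def)
    qed
    then show "\<forall>f L. isometry f \<longrightarrow> (\<forall>m. dist (y m) (f (y m)) \<le> L) \<longrightarrow> (f \<circ> \<gamma>, \<gamma>) \<in> asymptotic"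
      by blast
  qed
qed

section \<open>Isometries with a single fixed point at infinity\<close>

text \<open>If \<open>f\<close> raised the function, the drift ray along its powers would also have
  a fixed end, hence be asymptotic to \<open>c\<close>; but along the powers the Busemann function
  of \<open>c\<close> increases while that of the drift ray is unbounded below.\<close>

lemma busemann_isometry_le:
  fixes x :: 'a
  assumes f: "isometry f" and c: "geodesic_ray c" and fix_f: "boundary_fix f = {ray_end c}"
  shows "busemann c (f x) \<le> busemann c x"
proof (rule ccontr)
  assume neg: "\<not> ?thesis"
  define \<tau> where "\<tau> = busemann c (f x) - busemann c x"
  have \<tau>: "\<tau> > 0" using neg by (simp add: \<tau>_def)
  have df: "dist (f p) (f q) = dist p q" for p q using f by (simp add: isometry_def)
  have "(f \<circ> c, c) \<in> asymptotic"
    using ray_end_in_boundary_fix_iff[OF f c] fix_f by simp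
  \<comment> \<open>Since \<open>f \<circ> c\<close> and \<open>c\<close> are asymptotic, their
    Busemann functions differ by a constant.\<close>
  then have shift: "busemann c (f z) = busemann c z + \<tau>" for z
    using busemann_diff_eq[of "f \<circ> c" c "f z" "f x"]
    by (simp add: busemann_comp_isometry[OF f] \<tau>_def)
  define P where "P j = (f ^^ j) x" for j
  have P0: "P 0 = x" by (simp add: P_def)
  have bP: "busemann c (P j) = busemann c x + real j * \<tau>" for j
    by (induction j) (simp_all add: P_def shift algebra_simps)
  have dP: "dist (P (i + j)) (P (i + l)) = dist (P j) (P l)" for i j l
    by (induction i) (simp_all add: P_def df)
  define C where "C = dist x (f x) + 1"
  have C: "C > 0" by (simp add: C_def add_nonneg_pos)
  \<comment> \<open>Half of the shift, because \<open>exists_steady_start\<close> asks for progress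
    \<open>2 * e\<close> per step; the 1-Lipschitz property supplies \<open>\<tau>\<close>.\<close>
  define e where "e = \<tau> / 2"
  have e: "e > 0" using \<tau> by (simp add: e_def)
  have step: "dist (P j) (P (Suc j)) \<le> C" for j
    using dP[of j 0 1] by (simp add: P_def C_def)
  have far: "2 * e * real m \<le> dist (P 0) (P m)" for m
    using busemann_lipschitz[OF c, of "P m" "P 0"] by (simp add: bP e_def dist_commute mult.commute)
  \<comment> \<open>Applying the inverse of \<open>f ^^ i\<close> turns the tail of the orbit from
    index \<open>i\<close> into its beginning. So one path \<open>P\<close> serves for all
    \<open>m\<close>, and only the endpoint varies.\<close>
  have "\<exists>k. e * real m \<le> dist x (P k) \<and> (\<forall>j. real j * C \<le> e * real m \<longrightarrow>
      dist (P j) (P k) + e * real j \<le> dist x (P k) \<and> dist x (P j) \<le> C * real j)" for m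
  proof -
    obtain i where i: "i \<le> m" "e * real m \<le> dist (P i) (P m)"
      "\<And>j. real j * C \<le> e * real m \<Longrightarrow> dist (P i) (P (i + j)) \<le> C * j"
      "\<And>j. real j * C \<le> e * real m \<Longrightarrow> dist (P (i + j)) (P m) + e * j \<le> dist (P i) (P m)"
      using exists_steady_start[of m P C "real m" e, OF step order_refl far e C] by metis
    have "dist (P i) (P m) = dist x (P (m - i))" "dist (P (i + j)) (P m) = dist (P j) (P (m - i))"
      "dist (P i) (P (i + j)) = dist x (P j)" for j
      using dP[of i 0 "m - i"] dP[of i j "m - i"] dP[of i 0 j] i(1) by (simp_all add: P0)
    with i show ?thesis by (intro exI[of _ "m - i"]) simp
  qed
  then obtain k where k: "\<And>m. e * real m \<le> dist x (P (k m))"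
    "\<And>m j. real j * C \<le> e * real m \<Longrightarrow> dist (P j) (P (k m)) + e * real j \<le> dist x (P (k m))"
    "\<And>m j. real j * C \<le> e * real m \<Longrightarrow> dist x (P j) \<le> C * real j"
    by metis
  obtain \<gamma> where \<gamma>: "geodesic_ray \<gamma>" and drift: "\<forall>j. \<exists>m. real j * C \<le> e * real m \<and> busemann \<gamma> (P j) \<le> 1 - e * real j"
    and asym: "\<forall>g L. isometry g \<longrightarrow> (\<forall>m. dist (P (k m)) (g (P (k m))) \<le> L) \<longrightarrow> (g \<circ> \<gamma>, \<gamma>) \<in> asymptotic"
    by (rule exists_drift_ray[of e x "\<lambda>m. P (k m)" C "\<lambda>_. P" "\<lambda>j. C * real j", OF e k]) blast
  have b\<gamma>: "busemann \<gamma> (P j) \<le> 1 - e * real j" for j using drift by blast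
  have "dist (P j) (f (P j)) \<le> C" for j using step[of j] by (simp add: P_def)
  then have "ray_end \<gamma> \<in> boundary_fix f"
    using ray_end_in_boundary_fix_iff[OF f \<gamma>] asym f by blast
  then have "(c, \<gamma>) \<in> asymptotic"
    using fix_f ray_end_eq_iff[OF c \<gamma>] by auto
  then obtain B where B: "\<And>z. busemann c z \<le> busemann \<gamma> z + B"
    using busemann_asymptotic_bound by metis
  obtain j where j: "real j * e > 1 + B - busemann c x"
    using reals_Archimedean3[OF e] by blast
  have "busemann c x + real j * \<tau> \<le> 1 - e * real j + B"
    using B[of "P j"] b\<gamma>[of j] by (simp add: bP)
  moreover have "real j * \<tau> \<ge> 0" using \<tau> by simp
  ultimately show False using j by (simp add: mult.commute)
qed

end

end

section \<open>Words in the generators\<close>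

lemma isom_group_simps [simp]:
  "mult isom_group = (\<circ>)" "one isom_group = id" "f \<in> carrier isom_group \<longleftrightarrow> isometry f"
  by (simp_all add: isom_group_def)

lemma foldr_comp: "foldr (\<circ>) w g = foldr (\<circ>) w id \<circ> g"
  by (induction w) (auto simp: o_assoc)

lemma generate_imp_word:
  assumes "\<phi> \<in> generate isom_group S" "\<forall>s\<in>S. inv\<^bsub>isom_group\<^esub> s \<in> S"
  shows "\<exists>w. set w \<subseteq> S \<and> foldr (\<circ>) w id = \<phi>"
  using assms(1)
proof induction
  case one
  show ?case by (intro exI[of _ "[]"]) simp
next
  case (incl h)
  then show ?case by (intro exI[of _ "[h]"]) simp
next
  case (inv h)
  then show ?case using assms(2) by (intro exI[of _ "[inv\<^bsub>isom_group\<^esub> h]"]) simp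
next
  case (eng h1 h2)
  then obtain w1 w2 where w: "set w1 \<subseteq> S" "foldr (\<circ>) w1 id = h1" "set w2 \<subseteq> S" "foldr (\<circ>) w2 id = h2"
    by blast
  have "foldr (\<circ>) (w1 @ w2) id = h1 \<circ> h2"
    using w foldr_comp[of w1 h2] by (simp only: foldr_append)
  then show ?case using w by (intro exI[of _ "w1 @ w2"]) (simp only: isom_group_simps set_append Un_subset_iff)
qed

text \<open>As \<open>S\<close> is symmetric, each generated element is a product of letters, so the
  \<open>LEAST\<close> in \<open>word_norm\<close> is attained.\<close>

lemma word_norm_le_imp_word:
  assumes "\<phi> \<in> generate isom_group S" "\<forall>s\<in>S. inv\<^bsub>isom_group\<^esub> s \<in> S" "word_norm isom_group S \<phi> \<le> k"
  obtains w where "set w \<subseteq> S" "length w \<le> k" "foldr (\<circ>) w id = \<phi>"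
proof -
  have "\<exists>n w. set w \<subseteq> S \<and> length w = n \<and> foldr (\<circ>) w id = \<phi>"
    using generate_imp_word[OF assms(1,2)] by blast
  from LeastI_ex[OF this] show thesis
    using assms(3) that by (auto simp: word_norm_def)
qed

section \<open>Sublinear growth of the displacement\<close>

theorem proposition1p4:
  fixes \<Gamma>\<^sub>0 S :: "('a::metric_space \<Rightarrow> 'a) set" and x :: 'a
  assumes "cat0_space TYPE('a)"
    and "proper_space TYPE('a)"
    and "visibility_space TYPE('a)"
    and "subgroup \<Gamma>\<^sub>0 isom_group"
    and "S \<subseteq> \<Gamma>\<^sub>0"
    and "finite S"
    and "\<forall>s\<in>S. inv\<^bsub>isom_group\<^esub> s \<in> S"
    and "\<Gamma>\<^sub>0 = generate isom_group S"
    and "\<exists>\<xi>\<in>boundary_at_infinity. \<forall>\<phi>\<in>\<Gamma>\<^sub>0 - {\<one>\<^bsub>isom_group\<^esub>}. boundary_fix \<phi> = {\<xi>}"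
  shows "(\<lambda>k::nat. Max {dist x (\<phi> x) | \<phi>. \<phi> \<in> \<Gamma>\<^sub>0 \<and> word_norm isom_group S \<phi> \<le> k} / real k)
           \<longlonglongrightarrow> 0"
proof (rule LIMSEQ_I, rule ccontr)
  fix r :: real
  let ?D = "\<lambda>k. {dist x (\<phi> x) | \<phi>. \<phi> \<in> \<Gamma>\<^sub>0 \<and> word_norm isom_group S \<phi> \<le> k}"
  assume r: "r > 0" and "\<not> (\<exists>n0. \<forall>k\<ge>n0. norm (Max (?D k) / real k - 0) < r)"
  then have large: "\<exists>k\<ge>n0. r \<le> \<bar>Max (?D k) / real k\<bar>" for n0 by (force simp: not_less)
  note cat0 = assms(1) and proper = assms(2)
  have isom: "isometry g" if "g \<in> \<Gamma>\<^sub>0" for g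
    using subgroup.mem_carrier[OF assms(4) that] by simp
  have comp: "g \<circ> h \<in> \<Gamma>\<^sub>0" if "g \<in> \<Gamma>\<^sub>0" "h \<in> \<Gamma>\<^sub>0" for g h
    using subgroup.m_closed[OF assms(4) that] by simp
  have id: "id \<in> \<Gamma>\<^sub>0"
    using subgroup.one_closed[OF assms(4)] by simp
  have inverse: "\<exists>h\<in>\<Gamma>\<^sub>0. \<forall>z. h (g z) = z" if g: "g \<in> \<Gamma>\<^sub>0" for g
  proof
    show "inv\<^bsub>isom_group\<^esub> g \<in> \<Gamma>\<^sub>0" using subgroup.m_inv_closed[OF assms(4) g] .
    show "\<forall>z. (inv\<^bsub>isom_group\<^esub> g) (g z) = z"
      using group.l_inv[OF group_isom_group, of g] isom[OF g] by (simp add: fun_eq_iff)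
  qed
  have word: "foldr (\<circ>) w id \<in> \<Gamma>\<^sub>0" if "set w \<subseteq> S" for w
    using that assms(5) by (induction w) (auto simp: id comp)

  obtain c where c: "geodesic_ray c" and
    fix_c: "\<And>g. g \<in> \<Gamma>\<^sub>0 \<Longrightarrow> g \<noteq> id \<Longrightarrow> boundary_fix g = {ray_end c}"
    using assms(9) by (auto elim!: boundary_pointE)
  have le: "busemann c (g z) \<le> busemann c z" if "g \<in> \<Gamma>\<^sub>0" for g z
    using busemann_isometry_le[OF cat0 proper isom[OF that] c fix_c[OF that]] by (cases "g = id") auto
  \<comment> \<open>The inequality for \<open>g\<close> and for its inverse gives equality.\<close>
  have invariant: "busemann c (g z) = busemann c z" if "g \<in> \<Gamma>\<^sub>0" for g z
    using inverse[OF that] le[OF that] le by (metis antisym)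

  define C where "C = (\<Sum>s\<in>S. dist x (s x)) + 1"
  have C: "C > 0" unfolding C_def by (intro add_nonneg_pos sum_nonneg) auto
  have C_bound: "dist x (s x) \<le> C" if "s \<in> S" for s
    using member_le_sum[of s S "\<lambda>s. dist x (s x)"] that assms(6) by (simp add: C_def)
  define e where "e = r / 2"
  have e: "e > 0" using r by (simp add: e_def)

  \<comment> \<open>A long path in the orbit of \<open>x\<close> for each \<open>m\<close>: it comes
    from a word of length at most some \<open>k \<ge> m\<close>, so its steady range contains the
    one required for \<open>m\<close>.\<close>
  have "\<exists>y Q. e * real m \<le> dist x y \<and> (\<forall>j. real j * C \<le> e * real m \<longrightarrow>
      dist (Q j) y + e * real j \<le> dist x y \<and> dist x (Q j) \<le> C * real j
        \<and> busemann c (Q j) = busemann c x)" for m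
  proof -
    obtain k where k: "k \<ge> m" "r \<le> \<bar>Max (?D k) / real k\<bar>" using large by blast
    \<comment> \<open>For \<open>k = 0\<close> the quotient is 0 by convention, which is below
      \<open>r\<close>.\<close>
    have k0: "k > 0" using k(2) r by (cases k) auto
    have "?D k \<subseteq> (\<lambda>w. dist x (foldr (\<circ>) w id x)) ` {w. set w \<subseteq> S \<and> length w \<le> k}"
      using assms(7,8) by (force elim!: word_norm_le_imp_word)
    then have fin: "finite (?D k)"
      by (rule finite_subset) (intro finite_imageI finite_lists_length_le assms(6))
    have "word_norm isom_group S id \<le> 0"
      unfolding word_norm_def by (intro Least_le exI[of _ "[]"]) simp
    then have "?D k \<noteq> {}" using id by force
    from Max_in[OF fin this] obtain \<phi> where \<phi>: "\<phi> \<in> \<Gamma>\<^sub>0" "word_norm isom_group S \<phi> \<le> k" "Max (?D k) = dist x (\<phi> x)"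
      by auto
    obtain w where w: "set w \<subseteq> S" "length w \<le> k" "foldr (\<circ>) w id = \<phi>"
      using word_norm_le_imp_word \<phi>(1,2) assms(7,8) by metis
    \<comment> \<open>Prefixes of the word: \<open>g j x\<close> runs from \<open>x\<close> to
      \<open>\<phi> x\<close>, and consecutive points differ by one letter moved by the isometry
      \<open>g j\<close>.\<close>
    define g where "g j = foldr (\<circ>) (take j w) id" for j
    have g: "g j \<in> \<Gamma>\<^sub>0" for j
      unfolding g_def by (rule word) (use w(1) set_take_subset in fast)
    define n where "n = length w"
    have step: "dist (g j x) (g (Suc j) x) \<le> C" if "j < n" for j
    proof -
      have "g (Suc j) = g j \<circ> w ! j"
        using that foldr_comp[of "take j w" "w ! j"]
        by (simp add: g_def n_def take_Suc_conv_app_nth)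
      then have "dist (g j x) (g (Suc j) x) = dist x ((w ! j) x)"
        using isom[OF g] by (simp add: isometry_def)
      then show ?thesis using C_bound w(1) that by (simp add: n_def subset_code(1))
    qed
    have far: "2 * e * real k \<le> dist (g 0 x) (g n x)"
      using k(2) k0 w(3) \<phi>(3) by (simp add: g_def n_def e_def field_simps)
    have nk: "real n \<le> real k" using w(2) by (simp add: n_def)
    obtain i where i: "i \<le> n" "e * real k \<le> dist (g i x) (g n x)"
      "\<And>j. real j * C \<le> e * real k \<Longrightarrow> dist (g i x) (g (i + j) x) \<le> C * j"
      "\<And>j. real j * C \<le> e * real k \<Longrightarrow> dist (g (i + j) x) (g n x) + e * j \<le> dist (g i x) (g n x)"
      using exists_steady_start[of n "\<lambda>j. g j x" C "real k" e, OF step nk far e C] by metis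
    \<comment> \<open>Discarding the first \<open>i\<close> letters: \<open>h\<close> inverts
      \<open>g i\<close> and moves the steady part so that it starts at \<open>x\<close>, within the
      orbit.\<close>
    obtain h where h: "h \<in> \<Gamma>\<^sub>0" "\<And>z. h (g i z) = z" using inverse[OF g] by metis
    have "dist (h p) (h q) = dist p q" for p q using isom[OF h(1)] by (simp add: isometry_def)
    note dist_h = this this[of "g i x", unfolded h(2)]
    have "e * real m \<le> e * real k" using k(1) e by simp
    then show ?thesis
      using i by (intro exI[of _ "h (g n x)"] exI[of _ "\<lambda>j. h (g (i + j) x)"])
        (auto simp: dist_h invariant h(1) g)
  qed
  then obtain y Q where yQ: "\<And>m. e * real m \<le> dist x (y m)"
    "\<And>m j. real j * C \<le> e * real m \<Longrightarrow> dist (Q m j) (y m) + e * real j \<le> dist x (y m)"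
    "\<And>m j. real j * C \<le> e * real m \<Longrightarrow> dist x (Q m j) \<le> C * real j"
    "\<And>m j. real j * C \<le> e * real m \<Longrightarrow> busemann c (Q m j) = busemann c x"
    by metis
  obtain \<gamma> where \<gamma>: "geodesic_ray \<gamma>"
    and drift: "\<forall>j. \<exists>m. real j * C \<le> e * real m \<and> busemann \<gamma> (Q m j) \<le> 1 - e * real j"
    using exists_drift_ray[OF cat0 proper e yQ(1-3)] by metis
  \<comment> \<open>On a single level set of the Busemann function of \<open>c\<close>, that of
    \<open>\<gamma>\<close> is unbounded below.\<close>
  have drift': "\<exists>q. busemann c q = busemann c x \<and> busemann \<gamma> q < b" for b
  proof -
    obtain j where "real j * e > 1 - b" using reals_Archimedean3[OF e] by blast
    then show ?thesis using drift[rule_format, of j] yQ(4) by (force simp: mult.commute)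
  qed
  show False
  proof (cases "ray_end c = ray_end \<gamma>")
    case True
    then obtain B where "\<And>z. busemann c z \<le> busemann \<gamma> z + B"
      using ray_end_eq_iff[OF c \<gamma>] busemann_asymptotic_bound by metis
    with drift'[of "busemann c x - B"] show False by (metis less_diff_eq not_less)
  next
    case False
    then obtain \<sigma> where \<sigma>: "geodesic_line \<sigma>" "ray_end (\<lambda>t. \<sigma> (- t)) = ray_end c" "ray_end \<sigma> = ray_end \<gamma>"
      using assms(3) ray_end_in_boundary[OF c] ray_end_in_boundary[OF \<gamma>]
      unfolding visibility_space_def by blast
    have rays: "geodesic_ray (\<lambda>t. \<sigma> (- t))" "geodesic_ray \<sigma>"
      using \<sigma>(1) by (auto simp: geodesic_line_def geodesic_ray_def)
    obtain B where B: "\<And>z. busemann (\<lambda>t. \<sigma> (- t)) z \<le> busemann c z + B"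
      using \<sigma>(2) ray_end_eq_iff[OF rays(1) c] busemann_asymptotic_bound by metis
    obtain B' where B': "\<And>z. busemann \<sigma> z \<le> busemann \<gamma> z + B'"
      using \<sigma>(3) ray_end_eq_iff[OF rays(2) \<gamma>] busemann_asymptotic_bound by metis
    \<comment> \<open>The threshold makes the sum of the Busemann functions of the two ends of
      \<open>\<sigma>\<close> negative at \<open>q\<close>.\<close>
    obtain q where "busemann c q = busemann c x" "busemann \<gamma> q < - busemann c x - B - B'"
      using drift' by blast
    then show False
      using busemann_line_sum_nonneg[OF \<sigma>(1), of q] B[of q] B'[of q] by simp
  qed
qed

end
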